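(* For integers $k,l,m$, let $Q(k,l,m)$ and $R(k,l,m)$ denote the (uniquely determined) rational functions of $a,b,c,q,x$ satisfying $$\phi(aq^{k},bq^{l};cq^{m};q,x)=Q(k,l,m)\cdot\phi(aq,bq;cq;q,x)+R(k,l,m)\cdot\phi(a,b;c;q,x).$$ Then $$Q(k-1,l-1,m-1)\Big|_{(a,b,c)\mapsto(aq,bq,cq)}=\frac{(1-aq)(1-bq)\,x\,(c-abqx)}{(1-c)(1-cq)}\,R(k,l,m).$$
   Context: Here $q$ is a complex number with $0<|q|<1$, and $a,b,c$ are nonzero complex parameters satisfying E1: $c,\ a/b\notin q^{\mathbb{Z}}$ and E2: $a,\ b,\ c/a,\ c/b\notin q^{\mathbb{Z}}$. Put $(u)_n=\prod_{j=0}^{n-1}(1-uq^j)$ for $n\ge0$, and $$\phi(a,b;c;q,x)=\sum_{n\ge0}\frac{(a)_n(b)_n}{(q)_n(c)_n}x^n .$$ For every $(k,l,m)\in\mathbb{Z}^3$ there is a unique pair $(Q,R)$ of elements of $\mathbb{Q}(a,b,c,q,x)$ satisfying the displayed three term relation identically. The notation $|_{(a,b,c)\mapsto(aq,bq,cq)}$ means substituting $aq,bq,cq$ for $a,b,c$. *)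

theory Defs
  imports
    Complex_Main
    "HOL-Computational_Algebra.Computational_Algebra"
    "HOL-Computational_Algebra.Field_as_Ring"
begin

definition qpoch :: "complex \<Rightarrow> complex \<Rightarrow> nat \<Rightarrow> complex" where
  "qpoch u q n = (\<Prod>j<n. 1 - u * q ^ j)"

definition heine_phi :: "complex \<Rightarrow> complex \<Rightarrow> complex \<Rightarrow> complex \<Rightarrow> complex \<Rightarrow> complex" where
  "heine_phi a b c q x =
     (\<Sum>n. qpoch a q n * qpoch b q n / (qpoch q q n * qpoch c q n) * x ^ n)"

definition q_powers :: "complex \<Rightarrow> complex set" where
  "q_powers q = range (\<lambda>n::int. q powi n)"

definition admissible :: "complex \<Rightarrow> complex \<Rightarrow> complex \<Rightarrow> complex \<Rightarrow> bool" where
  "admissible a b c q \<longleftrightarrow>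
     0 < norm q \<and> norm q < 1 \<and> a \<noteq> 0 \<and> b \<noteq> 0 \<and> c \<noteq> 0 \<and>
     c \<notin> q_powers q \<and> a / b \<notin> q_powers q \<and>
     a \<notin> q_powers q \<and> b \<notin> q_powers q \<and> c / a \<notin> q_powers q \<and> c / b \<notin> q_powers q"

instance fract :: ("{idom, ring_char_0}") field_char_0
proof
  have "of_nat n = (Fract (of_nat n) 1 :: 'a fract)" for n
    by (induction n) (simp_all add: Zero_fract_def One_fract_def)
  then show "inj (of_nat :: nat \<Rightarrow> 'a fract)"
    by (auto intro!: injI simp: eq_fract)
qed

text \<open>
  The ring \<open>\<rat>[a,b,c,q,x]\<close> is represented as the iterated polynomial ring
  \<open>\<rat>[a][b][c][q][x]\<close>: the innermost indeterminate is \<open>a\<close>, the outermost one is \<open>x\<close>.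
\<close>

type_synonym pol5 = "rat poly poly poly poly poly"
type_synonym ratfun5 = "pol5 fract"

definition var_a :: ratfun5 where "var_a = to_fract [:[:[:[:[:0, 1:]:]:]:]:]"
definition var_b :: ratfun5 where "var_b = to_fract [:[:[:[:0, 1:]:]:]:]"
definition var_c :: ratfun5 where "var_c = to_fract [:[:[:0, 1:]:]:]"
definition var_q :: ratfun5 where "var_q = to_fract [:[:0, 1:]:]"
definition var_x :: ratfun5 where "var_x = to_fract [:0, 1:]"

text \<open>
  Evaluation takes place in an arbitrary field of characteristic 0. With values in \<^typ>\<open>complex\<close>
  it gives the values of a polynomial or rational function at a point; with values in
  \<^typ>\<open>ratfun5\<close> itself it is substitution of rational functions for the indeterminates.
\<close>

definition pol5_eval :: "pol5 \<Rightarrow> 'f \<Rightarrow> 'f \<Rightarrow> 'f \<Rightarrow> 'f \<Rightarrow> 'f \<Rightarrow> 'f::field_char_0" where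
  "pol5_eval p a b c q x =
     (let eval_a = (\<lambda>r. poly (map_poly of_rat r) a);
          eval_b = (\<lambda>r. poly (map_poly eval_a r) b);
          eval_c = (\<lambda>r. poly (map_poly eval_b r) c);
          eval_q = (\<lambda>r. poly (map_poly eval_c r) q)
      in poly (map_poly eval_q p) x)"

text \<open>
  Since \<^const>\<open>quot_of_fract\<close> yields numerator and denominator in lowest terms, the domain below
  is the largest possible one: if any fraction representing \<open>f\<close> has a denominator that does not
  vanish at the point, then the reduced denominator does not vanish there either.
\<close>

definition ratfun5_defined ::
    "ratfun5 \<Rightarrow> 'f \<Rightarrow> 'f \<Rightarrow> 'f \<Rightarrow> 'f \<Rightarrow> 'f::field_char_0 \<Rightarrow> bool" where
  "ratfun5_defined f a b c q x \<longleftrightarrow> pol5_eval (snd (quot_of_fract f)) a b c q x \<noteq> 0"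

definition ratfun5_eval :: "ratfun5 \<Rightarrow> 'f \<Rightarrow> 'f \<Rightarrow> 'f \<Rightarrow> 'f \<Rightarrow> 'f \<Rightarrow> 'f::field_char_0" where
  "ratfun5_eval f a b c q x =
     pol5_eval (fst (quot_of_fract f)) a b c q x / pol5_eval (snd (quot_of_fract f)) a b c q x"

text \<open>
  The relation is required at all admissible parameters and all \<open>x\<close> in the disc of convergence
  at which both coefficients are defined (they may have poles, for instance at \<open>x = 0\<close>).
\<close>

definition three_term_relation :: "int \<Rightarrow> int \<Rightarrow> int \<Rightarrow> ratfun5 \<Rightarrow> ratfun5 \<Rightarrow> bool" where
  "three_term_relation k l m Q R \<longleftrightarrow>
     (\<forall>a b c q x :: complex.
        admissible a b c q \<and> norm x < 1 \<and>
        ratfun5_defined Q a b c q x \<and> ratfun5_defined R a b c q x \<longrightarrow>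
        heine_phi (a * q powi k) (b * q powi l) (c * q powi m) q x =
          ratfun5_eval Q a b c q x * heine_phi (a * q) (b * q) (c * q) q x +
          ratfun5_eval R a b c q x * heine_phi a b c q x)"

end

theory Submission
  imports Defs "HOL-Analysis.FPS_Convergence"
begin

text \<open>
  Write \<open>\<phi>\<^sub>i = \<phi>(aq\<^sup>i, bq\<^sup>i; cq\<^sup>i; q, x)\<close>. Substituting \<open>(aq, bq, cq)\<close> for
  \<open>(a, b, c)\<close> in the relation for \<open>(k-1, l-1, m-1)\<close> writes \<open>\<phi>(aq\<^sup>k, bq\<^sup>l; cq\<^sup>m; q, x)\<close> as
  \<open>Q' \<phi>\<^sub>2 + R' \<phi>\<^sub>1\<close>, where \<open>Q'\<close> is the left-hand side of the claim. Heine's second order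
  \<open>q\<close>-difference equation is the relation
  \<open>x(c - abqx)(1 - aq)(1 - bq) \<phi>\<^sub>2 = -(1 - cq)(1 - c + (ab - a - b + abq)x) \<phi>\<^sub>1 + (1 - c)(1 - cq) \<phi>\<^sub>0\<close>
  (lemma \<open>heine_contiguous\<close>). Eliminating \<open>\<phi>\<^sub>2\<close> gives a second expression of
  \<open>\<phi>(aq\<^sup>k, bq\<^sup>l; cq\<^sup>m; q, x)\<close> through \<open>\<phi>\<^sub>1\<close> and \<open>\<phi>\<^sub>0\<close>, and the claim is that its coefficient of
  \<open>\<phi>\<^sub>0\<close> agrees with \<open>R(k,l,m)\<close>.

  Comparing coefficients is legitimate because, for every single admissible \<open>(a, b, c, q)\<close>, the
  functions \<open>\<phi>\<^sub>0\<close> and \<open>\<phi>\<^sub>1\<close> of \<open>x\<close> are linearly independent over the polynomials in \<open>x\<close>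
  (lemma \<open>heine_independent\<close>). The reason is elementary. In a relation \<open>P \<phi>\<^sub>1 + S \<phi>\<^sub>0 = 0\<close> the
  coefficient of \<open>x\<^sup>N\<close> is, for all large \<open>N\<close> and up to a nonzero factor, the value of one fixed
  polynomial at \<open>q\<^sup>N\<close>. That polynomial vanishes at infinitely many points, hence identically, in particular at the point where \<open>1 - cq\<^sup>N\<close> becomes
  \<open>0\<close>; there only the constant coefficient of \<open>P\<close> contributes, with a factor that is nonzero since
  \<open>c/a\<close> and \<open>c/b\<close> are not powers of \<open>q\<close>. So \<open>P\<close> and \<open>S\<close> are both divisible by \<open>x\<close>, and this can
  be repeated.

  Passing from values to rational functions uses that a nonzero polynomial in \<open>a, b, c, q, x\<close> does
  not vanish at all admissible parameters (lemma \<open>pol5_nonvanishing\<close>). Poles cause no difficulty: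
  multiplying a relation by all denominators makes it hold in the whole disc \<open>|x| < 1\<close>.
\<close>

section \<open>Evaluating polynomials in five indeterminates\<close>

text \<open>
  The single step of which the evaluation of an iterated polynomial is a fivefold nesting: \<open>h\<close>
  evaluates the coefficients, \<open>x\<close> is put for the outermost indeterminate.
\<close>

definition eval_by :: "('a::comm_ring_1 \<Rightarrow> 'f::field) \<Rightarrow> 'f \<Rightarrow> 'a poly \<Rightarrow> 'f" where
  "eval_by h x p = poly (map_poly h p) x"

definition is_hom :: "('a::comm_ring_1 \<Rightarrow> 'f::field) \<Rightarrow> bool" where
  "is_hom h \<longleftrightarrow> h 0 = 0 \<and> h 1 = 1 \<and>
     (\<forall>u v. h (u + v) = h u + h v) \<and> (\<forall>u v. h (u * v) = h u * h v)"

lemma eval_by_pCons: "h 0 = 0 \<Longrightarrow> eval_by h x (pCons u p) = h u + x * eval_by h x p"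
  by (simp add: eval_by_def map_poly_pCons)

lemma eval_by_0 [simp]: "eval_by h x 0 = 0"
  by (simp add: eval_by_def)

lemma is_hom_eval_by:
  assumes "is_hom h"
  shows "is_hom (eval_by h x)"
proof -
  have h: "h 0 = 0" "h 1 = 1" "\<And>u v. h (u + v) = h u + h v" "\<And>u v. h (u * v) = h u * h v"
    using assms by (auto simp: is_hom_def)
  note E = eval_by_pCons[of h, OF h(1)]
  have add: "eval_by h x (p + r) = eval_by h x p + eval_by h x r" for p r
    by (induction p r rule: poly_induct2) (simp_all add: E h algebra_simps)
  have smult: "eval_by h x (smult u r) = h u * eval_by h x r" for u r
    by (induction r) (simp_all add: E h algebra_simps)
  have "eval_by h x (p * r) = eval_by h x p * eval_by h x r" for p r
    by (induction p) (simp_all add: E h add smult algebra_simps)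
  moreover have "eval_by h x 1 = 1"
    by (simp add: one_pCons E h)
  ultimately show ?thesis
    by (simp add: is_hom_def add)
qed

lemma is_hom_of_rat: "is_hom (of_rat :: rat \<Rightarrow> 'f::field_char_0)"
  by (simp add: is_hom_def of_rat_add of_rat_mult)

lemma pol5_eval_eq_eval_by:
  "pol5_eval p a b c q x =
     eval_by (eval_by (eval_by (eval_by (eval_by of_rat a) b) c) q) x p"
  by (simp add: pol5_eval_def eval_by_def[abs_def])

lemma is_hom_pol5_eval: "is_hom (\<lambda>p. pol5_eval p a b c q x)"
  unfolding pol5_eval_eq_eval_by by (intro is_hom_eval_by is_hom_of_rat)

lemma pol5_eval_hom:
  "pol5_eval 0 a b c q x = 0" "pol5_eval 1 a b c q x = 1"
  "pol5_eval (p + r) a b c q x = pol5_eval p a b c q x + pol5_eval r a b c q x"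
  "pol5_eval (p * r) a b c q x = pol5_eval p a b c q x * pol5_eval r a b c q x"
  using is_hom_pol5_eval[of a b c q x] by (auto simp: is_hom_def)

lemma pol5_eval_diff:
  "pol5_eval (p - r) a b c q x = pol5_eval p a b c q x - pol5_eval r a b c q x"
  using pol5_eval_hom(3)[of "p - r" r a b c q x] by simp

definition pa :: pol5 where "pa = [:[:[:[:[:0, 1:]:]:]:]:]"
definition pb :: pol5 where "pb = [:[:[:[:0, 1:]:]:]:]"
definition pc :: pol5 where "pc = [:[:[:0, 1:]:]:]"
definition pq :: pol5 where "pq = [:[:0, 1:]:]"
definition px :: pol5 where "px = [:0, 1:]"

lemma var_eq_to_fract:
  "var_a = to_fract pa" "var_b = to_fract pb" "var_c = to_fract pc"
  "var_q = to_fract pq" "var_x = to_fract px"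
  by (simp_all add: var_a_def var_b_def var_c_def var_q_def var_x_def
      pa_def pb_def pc_def pq_def px_def)

lemma pol5_eval_var:
  "pol5_eval pa a b c q x = a" "pol5_eval pb a b c q x = b" "pol5_eval pc a b c q x = c"
  "pol5_eval pq a b c q x = q" "pol5_eval px a b c q x = x"
  by (simp_all add: pol5_eval_def pa_def pb_def pc_def pq_def px_def map_poly_pCons)

lemma pol5_eval_const: "pol5_eval [:[:[:[:[:r:]:]:]:]:] a b c q x = of_rat r"
  by (simp add: pol5_eval_def map_poly_pCons)

lemma poly_ring_induct:
  fixes p :: "'a::comm_ring_1 poly"
  assumes "\<And>u. P [:u:]" "P [:0, 1:]"
    and "\<And>p r. P p \<Longrightarrow> P r \<Longrightarrow> P (p + r)" "\<And>p r. P p \<Longrightarrow> P r \<Longrightarrow> P (p * r)"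
  shows "P p"
proof (induction p)
  case 0
  show ?case using assms(1)[of 0] by simp
next
  case (pCons u p)
  have "P ([:u:] + [:0, 1:] * p)"
    by (intro assms pCons)
  then show ?case by simp
qed

text \<open>
  The polynomial ring is generated by the constants and the five indeterminates, so a property that
  is stable under sums and products need only be checked there. This avoids nested inductions in
  what follows.
\<close>

lemma pol5_induct:
  assumes const: "\<And>r. P [:[:[:[:[:r:]:]:]:]:]"
    and var: "P pa" "P pb" "P pc" "P pq" "P px"
    and add: "\<And>p r. P p \<Longrightarrow> P r \<Longrightarrow> P (p + r)"
    and mult: "\<And>p r. P p \<Longrightarrow> P r \<Longrightarrow> P (p * r)"
  shows "P p"
proof -
  have 1: "P [:[:[:[:r:]:]:]:]" for r
  proof (rule poly_ring_induct[where P = "\<lambda>r. P [:[:[:[:r:]:]:]:]"])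
    show "P [:[:[:[:p + r:]:]:]:]" if "P [:[:[:[:p:]:]:]:]" "P [:[:[:[:r:]:]:]:]" for p r
      using add[OF that] by simp
    show "P [:[:[:[:p * r:]:]:]:]" if "P [:[:[:[:p:]:]:]:]" "P [:[:[:[:r:]:]:]:]" for p r
      using mult[OF that] by simp
  qed (use const var(1) in \<open>simp_all only: pa_def\<close>)
  have 2: "P [:[:[:r:]:]:]" for r
  proof (rule poly_ring_induct[where P = "\<lambda>r. P [:[:[:r:]:]:]"])
    show "P [:[:[:p + r:]:]:]" if "P [:[:[:p:]:]:]" "P [:[:[:r:]:]:]" for p r
      using add[OF that] by simp
    show "P [:[:[:p * r:]:]:]" if "P [:[:[:p:]:]:]" "P [:[:[:r:]:]:]" for p r
      using mult[OF that] by (simp add: mult.commute)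
  qed (use 1 var(2) in \<open>simp_all only: pb_def\<close>)
  have 3: "P [:[:r:]:]" for r
  proof (rule poly_ring_induct[where P = "\<lambda>r. P [:[:r:]:]"])
    show "P [:[:p + r:]:]" if "P [:[:p:]:]" "P [:[:r:]:]" for p r
      using add[OF that] by simp
    show "P [:[:p * r:]:]" if "P [:[:p:]:]" "P [:[:r:]:]" for p r
      using mult[OF that] by simp
  qed (use 2 var(3) in \<open>simp_all only: pc_def\<close>)
  have 4: "P [:r:]" for r
  proof (rule poly_ring_induct[where P = "\<lambda>r. P [:r:]"])
    show "P [:p + r:]" if "P [:p:]" "P [:r:]" for p r
      using add[OF that] by simp
    show "P [:p * r:]" if "P [:p:]" "P [:r:]" for p r
      using mult[OF that] by (simp add: mult.commute)
  qed (use 3 var(4) in \<open>simp_all only: pq_def\<close>)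
  show ?thesis
    by (rule poly_ring_induct[where P = P]) (use 4 var(5) add mult in \<open>simp_all only: px_def\<close>)
qed

lemma pol5_eval_poly_x:
  fixes a b c q :: complex
  shows "\<exists>P :: complex poly. \<forall>x. poly P x = pol5_eval p a b c q x"
  by (simp add: pol5_eval_eq_eval_by eval_by_def[of _ _ p]) blast

section \<open>Polynomials that vanish at all admissible parameters\<close>

lemma finite_zeros_eval_by:
  assumes "h 0 = 0" "h (lead_coeff p) \<noteq> 0"
  shows "finite {z. eval_by h z p = 0}"
proof -
  have "coeff (map_poly h p) (degree p) \<noteq> 0"
    using assms by (simp add: coeff_map_poly)
  then have "map_poly h p \<noteq> 0" by auto
  then show ?thesis
    unfolding eval_by_def by (rule poly_roots_finite)
qed

lemma infinite_unit_circle: "infinite {z::complex. norm z = 1}"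
proof
  assume fin: "finite {z::complex. norm z = 1}"
  have "n \<le> card {z::complex. norm z = 1}" if "n > 0" for n
  proof -
    have "norm z = 1" if "z ^ n = 1" for z :: complex
      using power_eq_1_iff[OF that] \<open>n > 0\<close> by simp
    then have "card {z::complex. z ^ n = 1} \<le> card {z::complex. norm z = 1}"
      by (intro card_mono fin) auto
    then show ?thesis using card_roots_unity_eq[OF that] by simp
  qed
  from this[of "Suc (card {z::complex. norm z = 1})"] show False by simp
qed

lemma infinite_punctured_disc: "infinite {q::complex. 0 < norm q \<and> norm q < 1}"
proof -
  have "inj (\<lambda>n. (1 / 2) ^ Suc n :: complex)"
  proof (rule injI)
    fix m n :: nat
    assume "(1 / 2) ^ Suc m = ((1 / 2) ^ Suc n :: complex)"
    then have "norm ((1 / 2) ^ Suc m :: complex) = norm ((1 / 2) ^ Suc n :: complex)" by simp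
    then show "m = n"
      using power_inject_exp'[of "1 / 2 :: real" "Suc m" "Suc n"]
      by (simp add: norm_mult norm_power norm_divide)
  qed
  then have "infinite (range (\<lambda>n. (1 / 2) ^ Suc n :: complex))"
    by (rule range_inj_infinite)
  moreover have "range (\<lambda>n. (1 / 2) ^ Suc n :: complex) \<subseteq> {q. 0 < norm q \<and> norm q < 1}"
    using power_Suc_less_one[of "1 / 2 :: real"] by (auto simp: norm_power norm_mult norm_divide)
  ultimately show ?thesis
    using finite_subset by blast
qed

lemma infinite_avoid_finite: "infinite A \<Longrightarrow> finite B \<Longrightarrow> \<exists>z\<in>A. z \<notin> B"
  by (meson finite_subset subsetI)

text \<open>
  Powers of \<open>q\<close> other than \<open>q\<^sup>0\<close> are off the unit circle. Hence parameters \<open>a, b, c\<close> on the unit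
  circle that are distinct from each other and from \<open>1\<close> are admissible for every \<open>q\<close>, and they can be
  chosen before \<open>q\<close>.
\<close>

lemma unit_not_q_power:
  fixes u q :: complex
  assumes "0 < norm q" "norm q < 1" "norm u = 1" "u \<noteq> 1"
  shows "u \<notin> q_powers q"
proof
  assume "u \<in> q_powers q"
  then obtain n :: int where n: "u = q powi n" by (auto simp: q_powers_def)
  then have 1: "norm q powi n = 1" using assms(3) by (simp add: norm_power_int)
  obtain m where m: "n = int m \<or> n = - int m" by (metis int_cases2)
  then have "norm q ^ m = 1" using 1 by (auto simp: power_int_minus)
  then have "m = 0" using power_eq_1_iff[of "norm q" m] assms(2) by simp
  then show False using n m assms(4) by auto
qed

text \<open>
  The values are chosen one after the other, from the innermost indeterminate outwards, each time
  such that the leading coefficient of the next layer survives. Every choice excludes finitely many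
  values from an infinite set: the unit circle for \<open>a, b, c\<close>, the punctured disc for \<open>q\<close>, and the
  whole plane for \<open>x\<close>. In particular \<open>x\<close> need not lie in the disc of convergence.
\<close>

lemma pol5_nonvanishing:
  assumes "p \<noteq> 0"
  obtains a b c q x :: complex
  where "admissible a b c q" "pol5_eval p a b c q x \<noteq> 0"
proof -
  define U where "U = {z::complex. norm z = 1}"
  have U: "infinite U" using infinite_unit_circle by (simp add: U_def)
  define r1 where "r1 = lead_coeff p"
  define r2 where "r2 = lead_coeff r1"
  define r3 where "r3 = lead_coeff r2"
  define r4 where "r4 = lead_coeff r3"
  have "r1 \<noteq> 0" "r2 \<noteq> 0" "r3 \<noteq> 0" "r4 \<noteq> 0"
    using assms by (simp_all add: r1_def r2_def r3_def r4_def)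
  have "finite {z. eval_by (of_rat :: rat \<Rightarrow> complex) z r4 = 0}"
    using \<open>r4 \<noteq> 0\<close> by (intro finite_zeros_eval_by) auto
  from infinite_avoid_finite[OF U, of "insert 1 _", OF finite.insertI, OF this]
  obtain a where a: "a \<in> U" "a \<noteq> 1" "eval_by of_rat a r4 \<noteq> 0" by auto
  have "finite {z. eval_by (eval_by of_rat a) z r3 = 0}"
    using a by (intro finite_zeros_eval_by) (auto simp: r4_def)
  from infinite_avoid_finite[OF U, of "insert 1 (insert a _)", OF finite.insertI, OF finite.insertI, OF this]
  obtain b where b: "b \<in> U" "b \<noteq> 1" "b \<noteq> a" "eval_by (eval_by of_rat a) b r3 \<noteq> 0" by auto
  have "finite {z. eval_by (eval_by (eval_by of_rat a) b) z r2 = 0}"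
    using b by (intro finite_zeros_eval_by) (auto simp: r3_def)
  from infinite_avoid_finite[OF U, of "insert 1 (insert a (insert b _))",
      OF finite.insertI, OF finite.insertI, OF finite.insertI, OF this]
  obtain c where c: "c \<in> U" "c \<noteq> 1" "c \<noteq> a" "c \<noteq> b"
    "eval_by (eval_by (eval_by of_rat a) b) c r2 \<noteq> 0" by auto
  have "finite {z. eval_by (eval_by (eval_by (eval_by of_rat a) b) c) z r1 = 0}"
    using c by (intro finite_zeros_eval_by) (auto simp: r2_def)
  from infinite_avoid_finite[OF infinite_punctured_disc this]
  obtain q where q: "0 < norm q" "norm q < 1"
    "eval_by (eval_by (eval_by (eval_by of_rat a) b) c) q r1 \<noteq> 0" by auto
  have "finite {z. eval_by (eval_by (eval_by (eval_by (eval_by of_rat a) b) c) q) z p = 0}"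
    using q by (intro finite_zeros_eval_by) (auto simp: r1_def)
  from infinite_avoid_finite[OF infinite_UNIV_char_0 this]
  obtain x where x: "pol5_eval p a b c q x \<noteq> 0"
    by (auto simp: pol5_eval_eq_eval_by)
  note q_free = unit_not_q_power[OF q(1,2)]
  have "norm a = 1" "norm b = 1" "norm c = 1" "a \<noteq> 0" "b \<noteq> 0" "c \<noteq> 0"
    using a(1) b(1) c(1) by (auto simp: U_def)
  then have "admissible a b c q"
    unfolding admissible_def using a(2) b(2,3) c(2-4) q(1,2)
    by (intro conjI q_free) (simp_all add: norm_divide)
  then show ?thesis using x that by blast
qed

section \<open>Shifting the parameters\<close>

text \<open>
  The substitution \<open>(a, b, c) \<mapsto> (aq, bq, cq)\<close> turns polynomials into polynomials. It is expressed here
  by an explicit polynomial \<open>N\<close>, which links the substitution inside the field of rational functions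
  to the shift of the complex parameters.
\<close>

lemma pol5_shift:
  "\<exists>N. pol5_eval p (var_a * var_q) (var_b * var_q) (var_c * var_q) var_q var_x = to_fract N \<and>
     (\<forall>a b c q x :: complex. pol5_eval N a b c q x = pol5_eval p (a * q) (b * q) (c * q) q x)"
  (is "\<exists>N. ?P p N")
proof (induction p rule: pol5_induct)
  case (1 r)
  have "\<exists>N. (of_rat r :: ratfun5) = to_fract N \<and> (\<forall>a b c q x::complex. pol5_eval N a b c q x = of_rat r)"
  proof (intro exI conjI allI)
    \<comment> \<open>\<open>of_rat\<close> agrees with the embedding of the constant polynomials, because both are ring
      homomorphisms on the rationals.\<close>
    define g :: "rat \<Rightarrow> ratfun5" where "g r = to_fract [:[:[:[:[:r:]:]:]:]:]" for r
    have g_add: "g (r + s) = g r + g s" for r s by (simp add: g_def flip: to_fract_add)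
    have g_mult: "g (r * s) = g r * g s" for r s by (simp add: g_def flip: to_fract_mult)
    have g1: "g 1 = 1" by (simp add: g_def flip: one_pCons)
    have g_nat: "g (of_nat n) = of_nat n" for n
      by (induction n) (simp_all add: g_add g1, simp add: g_def)
    have g_minus: "g (- r) = - g r" for r by (simp add: g_def flip: to_fract_uminus)
    have g_int: "g (of_int i) = of_int i" for i
      by (cases i) (simp_all add: g_nat g_minus g_add g1 del: of_nat_Suc)
    obtain m n where r: "r = of_int m / of_int n" "n \<noteq> 0"
      by (cases r) (auto simp: Fract_of_int_quotient)
    have "g r * of_int n = of_int m"
      using r by (simp flip: g_int g_mult)
    then have "g r = of_int m / of_int n"
      using r(2) by (simp add: nonzero_eq_divide_eq)
    also have "\<dots> = of_rat r" by (simp add: r(1) of_rat_divide)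
    finally have "g r = of_rat r" .
    then show "of_rat r = to_fract [:[:[:[:[:r:]:]:]:]:]" by (simp add: g_def)
  qed (rule pol5_eval_const)
  then show ?case by (simp add: pol5_eval_const)
next
  case 2
  show ?case
    by (rule exI[of _ "pa * pq"]) (simp add: pol5_eval_var pol5_eval_hom var_eq_to_fract)
next
  case 3
  show ?case
    by (rule exI[of _ "pb * pq"]) (simp add: pol5_eval_var pol5_eval_hom var_eq_to_fract)
next
  case 4
  show ?case
    by (rule exI[of _ "pc * pq"]) (simp add: pol5_eval_var pol5_eval_hom var_eq_to_fract)
next
  case 5
  show ?case
    by (rule exI[of _ pq]) (simp add: pol5_eval_var var_eq_to_fract)
next
  case 6
  show ?case
    by (rule exI[of _ px]) (simp add: pol5_eval_var var_eq_to_fract)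
next
  case (7 p r)
  then obtain M N where "?P p M" "?P r N" by blast
  then show ?case by (intro exI[of _ "M + N"]) (simp add: pol5_eval_hom)
next
  case (8 p r)
  then obtain M N where "?P p M" "?P r N" by blast
  then show ?case by (intro exI[of _ "M * N"]) (simp add: pol5_eval_hom)
qed

text \<open>
  The shift is invertible at points with \<open>q \<noteq> 0\<close>, so it cannot kill a polynomial; this keeps shifted
  denominators nonzero.
\<close>

lemma pol5_shift_nonzero:
  assumes "p \<noteq> 0"
    and N: "\<And>a b c q x :: complex. pol5_eval N a b c q x = pol5_eval p (a * q) (b * q) (c * q) q x"
  shows "N \<noteq> 0"
proof
  assume "N = 0"
  obtain a b c q x :: complex where "admissible a b c q" "pol5_eval p a b c q x \<noteq> 0"
    using pol5_nonvanishing[OF assms(1)] .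
  then show False
    using N[of "a / q" "b / q" "c / q" q x] \<open>N = 0\<close> by (auto simp: pol5_eval_hom admissible_def)
qed

section \<open>Heine's series as a power series\<close>

lemma qpoch_0 [simp]: "qpoch u q 0 = 1"
  by (simp add: qpoch_def)

lemma qpoch_Suc: "qpoch u q (Suc n) = qpoch u q n * (1 - u * q ^ n)"
  by (simp add: qpoch_def)

lemma qpoch_Suc_shift: "qpoch u q (Suc n) = (1 - u) * qpoch (u * q) q n"
  by (induction n) (simp_all add: qpoch_Suc mult_ac)

lemma q_powers_nonzero_factor:
  assumes "q \<noteq> 0" "u \<notin> q_powers q"
  shows "1 - u * q ^ n \<noteq> 0"
proof
  assume "1 - u * q ^ n = 0"
  then have "u = q powi (- int n)" using assms(1) by (simp add: power_int_minus field_simps)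
  then show False using assms(2) by (auto simp: q_powers_def)
qed

lemma qpoch_nonzero:
  assumes "q \<noteq> 0" "u \<notin> q_powers q"
  shows "qpoch u q n \<noteq> 0"
  using q_powers_nonzero_factor[OF assms] by (simp add: qpoch_def)

lemma power_Suc_neq_1:
  fixes q :: complex
  assumes "norm q < 1"
  shows "q * q ^ n \<noteq> 1"
proof
  assume "q * q ^ n = 1"
  then show False using power_eq_1_iff[of q "Suc n"] assms by simp
qed

lemma qpoch_q_nonzero: "norm q < 1 \<Longrightarrow> qpoch q q n \<noteq> 0"
  using power_Suc_neq_1[of q] by (auto simp: qpoch_def)

lemma shift_q_powers:
  assumes "q \<noteq> 0" "u \<notin> q_powers q"
  shows "u * q \<notin> q_powers q"
proof
  assume "u * q \<in> q_powers q"
  then obtain n :: int where "u * q = q powi n" by (auto simp: q_powers_def)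
  then have "u = q powi (n - 1)" using assms(1) by (simp add: power_int_diff field_simps)
  then show False using assms(2) by (auto simp: q_powers_def)
qed

lemma admissible_shift:
  assumes "admissible a b c q"
  shows "admissible (a * q) (b * q) (c * q) q"
  using assms shift_q_powers by (auto simp: admissible_def)

lemma admissible_qpoch_nonzero:
  assumes "admissible a b c q"
  shows "qpoch a q n \<noteq> 0" "qpoch b q n \<noteq> 0" "qpoch c q n \<noteq> 0" "qpoch q q n \<noteq> 0"
  using assms by (simp_all add: admissible_def qpoch_nonzero qpoch_q_nonzero)

definition heine_fps :: "complex \<Rightarrow> complex \<Rightarrow> complex \<Rightarrow> complex \<Rightarrow> complex fps" where
  "heine_fps a b c q = Abs_fps (\<lambda>n. qpoch a q n * qpoch b q n / (qpoch q q n * qpoch c q n))"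

lemma eval_heine_fps: "eval_fps (heine_fps a b c q) x = heine_phi a b c q x"
  by (simp add: eval_fps_def heine_fps_def heine_phi_def)

text \<open>
  The ratio of consecutive coefficients tends to \<open>1\<close> because \<open>q\<^sup>n\<close> tends to \<open>0\<close>.
\<close>

lemma fps_conv_radius_heine_fps:
  assumes "admissible a b c q"
  shows "fps_conv_radius (heine_fps a b c q) = 1"
proof -
  have q: "norm q < 1" "q \<noteq> 0" using assms by (auto simp: admissible_def)
  note nz = admissible_qpoch_nonzero[OF assms]
  have ratio: "norm (fps_nth (heine_fps a b c q) n) / norm (fps_nth (heine_fps a b c q) (Suc n)) =
      norm ((1 - q * q ^ n) * (1 - c * q ^ n) / ((1 - a * q ^ n) * (1 - b * q ^ n)))" for n
    using nz[of n] by (simp add: heine_fps_def qpoch_Suc norm_divide norm_mult)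
  have lim: "(\<lambda>n. q ^ n) \<longlonglongrightarrow> 0" using q by (simp add: LIMSEQ_power_zero)
  have "(\<lambda>n. norm ((1 - q * q ^ n) * (1 - c * q ^ n) / ((1 - a * q ^ n) * (1 - b * q ^ n))))
      \<longlonglongrightarrow> norm ((1 - q * 0) * (1 - c * 0) / ((1 - a * 0) * (1 - b * 0)))"
    by (intro tendsto_intros lim) simp
  then have "(\<lambda>n. norm (fps_nth (heine_fps a b c q) n) / norm (fps_nth (heine_fps a b c q) (Suc n))) \<longlonglongrightarrow> 1"
    unfolding ratio by simp
  then have "conv_radius (fps_nth (heine_fps a b c q)) = 1"
    by (intro conv_radius_ratio_limit_nonzero[where c = 1]) (simp_all add: one_ereal_def)
  then show ?thesis by (simp add: fps_conv_radius_def)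
qed

lemma eval_poly_times_heine_fps:
  assumes "admissible a b c q" "norm x < 1"
  shows "ereal (norm x) < fps_conv_radius (fps_of_poly P * heine_fps a b c q)"
    and "eval_fps (fps_of_poly P * heine_fps a b c q) x = poly P x * heine_phi a b c q x"
proof -
  have x: "ereal (norm x) < 1" using assms(2) by simp
  have "1 \<le> fps_conv_radius (fps_of_poly P * heine_fps a b c q)"
    using fps_conv_radius_mult[of "fps_of_poly P" "heine_fps a b c q"]
      fps_conv_radius_heine_fps[OF assms(1)] by simp
  with x show "ereal (norm x) < fps_conv_radius (fps_of_poly P * heine_fps a b c q)"
    by (rule less_le_trans)
  show "eval_fps (fps_of_poly P * heine_fps a b c q) x = poly P x * heine_phi a b c q x"
    using x fps_conv_radius_heine_fps[OF assms(1)] by (simp add: eval_fps_mult eval_heine_fps)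
qed

section \<open>The contiguous relation\<close>

lemma poly_pCons_times_fps:
  fixes F :: "'a::comm_ring_1 fps"
  shows "fps_of_poly (pCons k P) * F = fps_const k * F + fps_X * (fps_of_poly P * F)"
  by (simp add: fps_of_poly_pCons algebra_simps)

text \<open>
  This is Heine's \<open>q\<close>-difference equation: the \<open>q\<close>-derivative of \<open>\<phi>\<^sub>0\<close> is a multiple of \<open>\<phi>\<^sub>1\<close>, and its
  second \<open>q\<close>-derivative is a multiple of \<open>\<phi>\<^sub>2\<close>. With \<open>u, v, w\<close> for the coefficients of
  \<open>\<phi>\<^sub>0, \<phi>\<^sub>1, \<phi>\<^sub>2\<close>, these two facts express \<open>u\<^bsub>n+1\<^esub>\<close> by \<open>v\<^bsub>n\<^esub>\<close> and \<open>w\<^bsub>n\<^esub>\<close> by \<open>v\<^bsub>n+1\<^esub>\<close>; together with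
  the recursion for \<open>v\<close> they reduce the comparison of coefficients to a polynomial identity in \<open>q\<^sup>n\<close>.
\<close>

lemma heine_contiguous_fps:
  assumes "admissible a b c q"
  shows "fps_of_poly [:0, c * (1 - a * q) * (1 - b * q), - (a * b * q * (1 - a * q) * (1 - b * q)):] *
      heine_fps (a * q * q) (b * q * q) (c * q * q) q =
    fps_of_poly [:- ((1 - c * q) * (1 - c)), - ((1 - c * q) * (a * b - a - b + a * b * q)):] *
      heine_fps (a * q) (b * q) (c * q) q +
    fps_const ((1 - c) * (1 - c * q)) * heine_fps a b c q"
    (is "?E * ?F2 = ?A * ?F1 + ?K * ?F0")
proof (rule fps_ext)
  fix n
  have q: "norm q < 1" "q \<noteq> 0" using assms by (auto simp: admissible_def)
  define u where "u n = fps_nth ?F0 n" for n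
  define v where "v n = fps_nth ?F1 n" for n
  define w where "w n = fps_nth ?F2 n" for n
  have q1: "1 - q * q ^ n \<noteq> 0" for n using power_Suc_neq_1[OF q(1)] by auto
  have c: "1 - c * q ^ n \<noteq> 0" for n
    using assms q by (intro q_powers_nonzero_factor) (auto simp: admissible_def)
  have c01: "1 - c \<noteq> 0" "1 - c * q \<noteq> 0" "1 - c * (q * q ^ n) \<noteq> 0" for n
    using c[of 0] c[of 1] c[of "Suc n"] by simp_all
  have uv: "u (Suc n) * (1 - q * q ^ n) * (1 - c) = (1 - a) * (1 - b) * v n" for n
  proof -
    have "u (Suc n) = (1 - a) * (1 - b) / ((1 - c) * (1 - q * q ^ n)) * v n"
      by (simp add: u_def v_def heine_fps_def qpoch_Suc_shift[of a] qpoch_Suc_shift[of b]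
          qpoch_Suc_shift[of c] qpoch_Suc[of q] mult_ac)
    then show ?thesis using c01(1) q1[of n] by simp
  qed
  have vw: "v (Suc n) * (1 - q * q ^ n) * (1 - c * q) = (1 - a * q) * (1 - b * q) * w n" for n
  proof -
    have "v (Suc n) = (1 - a * q) * (1 - b * q) / ((1 - c * q) * (1 - q * q ^ n)) * w n"
      by (simp add: w_def v_def heine_fps_def qpoch_Suc_shift[of "a * q"] qpoch_Suc_shift[of "b * q"]
          qpoch_Suc_shift[of "c * q"] qpoch_Suc[of q] mult_ac)
    then show ?thesis using c01(2) q1[of n] by simp
  qed
  have vv: "v (Suc n) * (1 - q * q ^ n) * (1 - c * (q * q ^ n)) =
      (1 - a * (q * q ^ n)) * (1 - b * (q * q ^ n)) * v n" for n
  proof -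
    have "v (Suc n) = (1 - a * (q * q ^ n)) * (1 - b * (q * q ^ n)) /
        ((1 - c * (q * q ^ n)) * (1 - q * q ^ n)) * v n"
      by (simp add: v_def heine_fps_def qpoch_Suc mult_ac)
    then show ?thesis using c01(3)[of n] q1[of n] by simp
  qed
  have v0: "u 0 = 1" "v 0 = 1" by (simp_all add: u_def v_def heine_fps_def)
  show "fps_nth (?E * ?F2) n = fps_nth (?A * ?F1 + ?K * ?F0) n"
  proof (cases n)
    case 0
    then show ?thesis
      using v0 by (simp add: fps_of_poly_pCons algebra_simps u_def v_def)
  next
    case (Suc n)
    have E: "fps_nth (?E * ?F2) (Suc n) =
        (1 - c * q) * (c * (1 - q * q ^ n) * v (Suc n) - a * b * q * (1 - q ^ n) * v n)"
    proof (cases n)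
      case 0
      have "fps_nth (?E * ?F2) (Suc 0) = c * (1 - a * q) * (1 - b * q) * w 0"
        by (simp add: fps_of_poly_pCons w_def)
      then show ?thesis
        unfolding 0 power_0 using vw[of 0, unfolded power_0] by algebra
    next
      case (Suc j)
      have "fps_nth (?E * ?F2) (Suc (Suc j)) =
          c * (1 - a * q) * (1 - b * q) * w (Suc j) - a * b * q * (1 - a * q) * (1 - b * q) * w j"
        by (simp add: poly_pCons_times_fps w_def)
      also have "\<dots> = c * ((1 - a * q) * (1 - b * q) * w (Suc j)) -
          a * b * q * ((1 - a * q) * (1 - b * q) * w j)"
        by (simp add: mult.assoc)
      also have "\<dots> = (1 - c * q) *
          (c * (1 - q * q ^ Suc j) * v (Suc (Suc j)) - a * b * q * (1 - q * q ^ j) * v (Suc j))"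
        unfolding vw[symmetric] by (simp add: algebra_simps)
      finally show ?thesis by (simp add: Suc)
    qed
    have A: "fps_nth (?A * ?F1 + ?K * ?F0) (Suc n) = 
       - ((1 - c * q) * (1 - c)) * v (Suc n) - (1 - c * q) * (a * b - a - b + a * b * q) * v n
       + (1 - c) * (1 - c * q) * u (Suc n)"
      by (simp add: fps_of_poly_pCons u_def v_def algebra_simps)
    \<comment> \<open>Multiplied by \<open>1 - q\<^bsup>n+1\<^esup>\<close>, both \<open>u\<^bsub>n+1\<^esub>\<close> and \<open>v\<^bsub>n+1\<^esub>\<close> reduce to \<open>v\<^bsub>n\<^esub>\<close>.\<close>
    have "(1 - q * q ^ n) * (fps_nth (?E * ?F2) (Suc n)) = (1 - q * q ^ n) * (fps_nth (?A * ?F1 + ?K * ?F0) (Suc n))"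
    proof -
      define y where "y = q ^ n"
      have 1: "u (Suc n) * (1 - q * y) * (1 - c) = (1 - a) * (1 - b) * v n"
        and 2: "v (Suc n) * (1 - q * y) * (1 - c * (q * y)) = (1 - a * (q * y)) * (1 - b * (q * y)) * v n"
        using uv[of n] vv[of n] by (simp_all add: y_def)
      show ?thesis
        unfolding E A y_def[symmetric] using 1 2 by algebra
    qed
    then show ?thesis using q1[of n] Suc by simp
  qed
qed

lemma heine_contiguous:
  assumes "admissible a b c q" "norm x < 1"
  shows "x * (c - a * b * q * x) * (1 - a * q) * (1 - b * q) *
      heine_phi (a * q * q) (b * q * q) (c * q * q) q x =
    - (1 - c * q) * (1 - c + (a * b - a - b + a * b * q) * x) * heine_phi (a * q) (b * q) (c * q) q x +
    (1 - c) * (1 - c * q) * heine_phi a b c q x"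
proof -
  note adm = assms(1) admissible_shift[OF assms(1)] admissible_shift[OF admissible_shift[OF assms(1)]]
  note eval = eval_poly_times_heine_fps[OF _ assms(2)]
  have "eval_fps (fps_of_poly [:0, c * (1 - a * q) * (1 - b * q), - (a * b * q * (1 - a * q) * (1 - b * q)):] *
          heine_fps (a * q * q) (b * q * q) (c * q * q) q) x =
      eval_fps (fps_of_poly [:- ((1 - c * q) * (1 - c)), - ((1 - c * q) * (a * b - a - b + a * b * q)):] *
          heine_fps (a * q) (b * q) (c * q) q) x +
      eval_fps (fps_of_poly [:(1 - c) * (1 - c * q):] * heine_fps a b c q) x"
    by (subst heine_contiguous_fps[OF assms(1)], subst eval_fps_add)
       (simp_all only: eval(1) adm flip: fps_of_poly_const)
  then show ?thesis
    by (simp add: eval(2) adm) (simp add: algebra_simps)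
qed

section \<open>Linear independence of two contiguous series\<close>

text \<open>
  A product of factors \<open>1 - u q\<^bsup>s\<^esup> y\<close>, as a polynomial in \<open>y\<close>. The variable \<open>y\<close> stands for a power
  \<open>q\<^bsup>m+1\<^esup>\<close>, so that quotients of \<open>q\<close>-shifted factorials become values of these polynomials.
\<close>

definition qfactor_poly :: "complex \<Rightarrow> complex \<Rightarrow> nat set \<Rightarrow> complex poly" where
  "qfactor_poly u q S = (\<Prod>s\<in>S. [:1, - (u * q ^ s):])"

lemma poly_qfactor_poly: "poly (qfactor_poly u q S) y = (\<Prod>s\<in>S. 1 - u * y * q ^ s)"
  by (simp add: qfactor_poly_def poly_prod mult_ac)

lemma qpoch_split:
  assumes "k \<le> n"
  shows "qpoch (u * q) q (m + n) =
    qpoch (u * q) q (m + k) * poly (qfactor_poly u q {k..<n}) (q ^ Suc m)"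
  using assms
proof (induction rule: dec_induct)
  case base
  then show ?case by (simp add: poly_qfactor_poly)
next
  case (step n)
  then show ?case
    by (simp add: qpoch_Suc poly_qfactor_poly power_add mult_ac)
qed

text \<open>
  Let \<open>d\<close> bound the degrees of \<open>P\<close> and \<open>S\<close>. After division by a common nonzero factor \<open>e\<close>, the
  coefficient of \<open>x\<^bsup>m+d+1\<^esup>\<close> in the relation is the value at \<open>y = q\<^bsup>m+1\<^esup>\<close> of a polynomial \<open>T\<close> that does
  not depend on \<open>m\<close>, hence \<open>T = 0\<close>. At \<open>y = 1/(cq\<^sup>d)\<close> the factor \<open>1 - cyq\<^sup>d\<close> annihilates every term of
  \<open>T\<close> except the one with the constant coefficient of \<open>P\<close>: with \<open>N = m+d+1\<close> this
  factor is \<open>1 - cq\<^sup>N\<close>, and among the coefficients of \<open>\<phi>\<^sub>1\<close> and \<open>\<phi>\<^sub>0\<close> up to \<open>x\<^sup>N\<close> only the last one of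
  \<open>\<phi>\<^sub>1\<close>, with denominator \<open>(cq)\<^sub>N\<close>, contains it.
\<close>

lemma heine_independent_0:
  assumes adm: "admissible a b c q"
    and rel: "fps_of_poly P * heine_fps (a * q) (b * q) (c * q) q + fps_of_poly S * heine_fps a b c q = 0"
  shows "coeff P 0 = 0" "coeff S 0 = 0"
proof -
  have q: "norm q < 1" "q \<noteq> 0" and c0: "c \<noteq> 0" using adm by (auto simp: admissible_def)
  define u where "u n = fps_nth (heine_fps a b c q) n" for n
  define v where "v n = fps_nth (heine_fps (a * q) (b * q) (c * q) q) n" for n
  define d where "d = max (degree P) (degree S)"
  define \<kappa> where "\<kappa> = (1 - a) * (1 - b) / (1 - c)"
  define G where "G w S = qfactor_poly w q S" for w S
  \<comment> \<open>The values of \<open>V i\<close> and \<open>W i\<close> at \<open>q\<^bsup>m+1\<^esup>\<close> are the coefficients of \<open>x\<^bsup>m+d+1-i\<^esup>\<close> in \<open>\<phi>\<^sub>1\<close> and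
    \<open>\<phi>\<^sub>0\<close>, divided by a factor common to all \<open>i\<close>.\<close>
  define V where "V i = G a {0..<d+1-i} * G b {0..<d+1-i} * G 1 {d+1-i..<d+1} * G c {d+1-i..<d+1}" for i
  define W where "W i = smult \<kappa> (G a {0..<d-i} * G b {0..<d-i} * G 1 {d+1-i..<d+1} * G c {d-i..<d+1})" for i
  define T where "T = (\<Sum>i\<le>d. smult (coeff P i) (V i) + smult (coeff S i) (W i))"
  have nz: "qpoch (a*q) q n \<noteq> 0" "qpoch (b*q) q n \<noteq> 0" "qpoch (c*q) q n \<noteq> 0" "qpoch q q n \<noteq> 0" for n
    using admissible_qpoch_nonzero[OF admissible_shift[OF adm]] by auto
  have c1: "1 - c \<noteq> 0"
    using adm q q_powers_nonzero_factor[of q c 0] by (auto simp: admissible_def)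
  have coef0: "coeff P i = 0" "coeff S i = 0" if "i > d" for i
    using that by (auto simp: d_def coeff_eq_0)
  have root: "poly T (q ^ Suc m) = 0" for m
  proof -
    define y where "y = q ^ Suc m"
    define e where "e = qpoch (a*q) q m * qpoch (b*q) q m /
       (qpoch (1*q) q (m + (d+1)) * qpoch (c*q) q (m + (d+1)))"
    have e: "e \<noteq> 0" using nz by (simp add: e_def)
    have split: "qpoch (w*q) q (m + n) = qpoch (w*q) q (m + k) * poly (G w {k..<n}) y" if "k \<le> n" for w k n
      using qpoch_split[OF that] by (simp add: G_def y_def)
    have split0: "qpoch (w*q) q (m + n) = qpoch (w*q) q m * poly (G w {0..<n}) y" for w n
      using split[of 0 n w] by simp
    have Gnz: "poly (G w {k..<d+1}) y \<noteq> 0" if "w = 1 \<or> w = c" "k \<le> d+1" for w k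
      using split[OF that(2), of w] nz[of "m + (d+1)"] that(1) by auto
    have frac: "A * x * (B * z) / (Q * C) = A * B / (Q * s * (C * t)) * (x * z * s * t)"
      if "s \<noteq> 0" "t \<noteq> 0" for A x B z Q C s t :: complex
      using that by simp
    have v: "v (m + (d + 1 - i)) = e * poly (V i) y" for i
    proof -
      define k where "k = d + 1 - i"
      have k: "k \<le> d + 1" by (simp add: k_def)
      have "v (m + k) = qpoch (a*q) q (m + k) * qpoch (b*q) q (m + k) /
          (qpoch (1*q) q (m + k) * qpoch (c*q) q (m + k))"
        by (simp add: v_def heine_fps_def)
      also have "\<dots> = e * poly (V i) y"
        unfolding e_def V_def k_def[symmetric] poly_mult split0[of a] split0[of b]
          split[OF k, of 1] split[OF k, of c]
        by (rule frac) (use Gnz k in auto)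
      finally show ?thesis by (simp only: k_def)
    qed
    have u: "u (m + (d + 1 - i)) = e * poly (W i) y" if i: "i \<le> d" for i
    proof -
      define k where "k = d - i"
      have k: "k \<le> d + 1" "k + 1 \<le> d + 1" using i by (simp_all add: k_def)
      have k_eq: "d + 1 - i = k + 1" using i by (simp add: k_def)
      have "u (m + (k + 1)) = \<kappa> * (qpoch (a*q) q (m + k) * qpoch (b*q) q (m + k) /
          (qpoch (1*q) q (m + (k + 1)) * qpoch (c*q) q (m + k)))"
        unfolding u_def heine_fps_def \<kappa>_def
        by (simp add: qpoch_Suc_shift[of a] qpoch_Suc_shift[of b] qpoch_Suc_shift[of c] mult_ac)
      also have "qpoch (a*q) q (m + k) * qpoch (b*q) q (m + k) /
          (qpoch (1*q) q (m + (k + 1)) * qpoch (c*q) q (m + k)) =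
          e * (poly (G a {0..<k}) y * poly (G b {0..<k}) y *
            poly (G 1 {k+1..<d+1}) y * poly (G c {k..<d+1}) y)"
        unfolding e_def split0[of a] split0[of b] split[OF k(2), of 1] split[OF k(1), of c]
        by (rule frac) (use Gnz k in auto)
      finally show ?thesis
        unfolding W_def k_eq k_def[symmetric] by simp
    qed
    have "0 = fps_nth (fps_of_poly P * heine_fps (a * q) (b * q) (c * q) q +
        fps_of_poly S * heine_fps a b c q) (m + (d+1))"
      using rel by simp
    also have "\<dots> = (\<Sum>i=0..m + (d+1). coeff P i * v (m + (d+1) - i) + coeff S i * u (m + (d+1) - i))"
      by (simp add: fps_mult_nth u_def v_def sum.distrib)
    also have "\<dots> = (\<Sum>i\<le>d. coeff P i * v (m + (d+1) - i) + coeff S i * u (m + (d+1) - i))"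
      by (intro sum.mono_neutral_right) (auto simp: coef0)
    also have "\<dots> = (\<Sum>i\<le>d. e * poly (smult (coeff P i) (V i) + smult (coeff S i) (W i)) y)"
    proof (rule sum.cong)
      fix i assume "i \<in> {..d}"
      then have i: "i \<le> d" by simp
      then have "m + (d+1) - i = m + (d+1-i)" by simp
      then show "coeff P i * v (m + (d+1) - i) + coeff S i * u (m + (d+1) - i) =
          e * poly (smult (coeff P i) (V i) + smult (coeff S i) (W i)) y"
        using u[OF i] v[of i] by (simp add: algebra_simps)
    qed simp
    also have "\<dots> = e * poly T y"
      by (simp add: T_def poly_sum sum_distrib_left)
    finally show ?thesis using e by (simp add: y_def)
  qed
  have "inj (\<lambda>m. q ^ Suc m)"
  proof (rule linorder_injI)
    fix i j :: nat assume "i < j"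
    then obtain k where "j = i + Suc k" by (metis add_Suc_right less_imp_Suc_add)
    then show "q ^ Suc i \<noteq> q ^ Suc j" 
      using power_Suc_neq_1[OF q(1), of k] q(2) by (auto simp: power_add)
  qed
  then have "infinite (range (\<lambda>m. q ^ Suc m))" by (simp add: range_inj_infinite)
  moreover have "range (\<lambda>m. q ^ Suc m) \<subseteq> {y. poly T y = 0}" using root by blast
  ultimately have "T = 0" using poly_roots_finite finite_subset by blast
  \<comment> \<open>The point at which \<open>1 - cyq\<^sup>d\<close> vanishes.\<close>
  define y where "y = 1 / (c * q ^ d)"
  have van: "poly (G c {k..<d+1}) y = 0" if "k \<le> d" for k
    unfolding G_def poly_qfactor_poly
    by (rule prod_zero[OF _ bexI[of _ d]]) (use that q c0 in \<open>auto simp: y_def\<close>)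
  have "0 = poly T y" using \<open>T = 0\<close> by simp
  also have "\<dots> = (\<Sum>i\<le>d. if i = 0 then coeff P 0 * poly (V 0) y else 0)"
    unfolding T_def poly_sum
    by (intro sum.cong) (auto simp: V_def W_def van simp del: One_nat_def)
  also have "\<dots> = coeff P 0 * poly (V 0) y" by simp
  finally have "coeff P 0 * poly (V 0) y = 0" by simp
  moreover have "poly (G w {0..<d+1}) y \<noteq> 0" if "c / w \<notin> q_powers q" "w \<noteq> 0" for w
  proof -
    have "1 - w * y * q ^ s \<noteq> 0" for s
    proof
      assume "1 - w * y * q ^ s = 0"
      then have "c / w = q powi (int s - int d)"
        using c0 q that(2) by (simp add: y_def power_int_diff field_simps)
      then show False using that(1) by (auto simp: q_powers_def)
    qed
    then show ?thesis by (simp add: G_def poly_qfactor_poly)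
  qed
  then have "poly (G a {0..<d+1}) y \<noteq> 0" "poly (G b {0..<d+1}) y \<noteq> 0"
    using adm by (auto simp: admissible_def)
  then have "poly (V 0) y \<noteq> 0"
    by (simp add: V_def) (simp add: G_def qfactor_poly_def)
  ultimately show P0: "coeff P 0 = 0" by simp
  \<comment> \<open>Both series have constant coefficient \<open>1\<close>, so the constant coefficients of \<open>P\<close> and \<open>S\<close> add up to \<open>0\<close>.\<close>
  have "coeff P 0 * v 0 + coeff S 0 * u 0 = 0"
    using arg_cong[OF rel, of "\<lambda>f. fps_nth f 0"] by (simp add: u_def v_def)
  then show "coeff S 0 = 0" using P0 by (simp add: u_def heine_fps_def)
qed

text \<open>
  Both constant coefficients vanish, so the relation can be divided by \<open>x\<close>; iterating this kills all
  coefficients.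
\<close>

lemma heine_independent_fps:
  assumes adm: "admissible a b c q"
    and rel: "fps_of_poly P * heine_fps (a * q) (b * q) (c * q) q + fps_of_poly S * heine_fps a b c q = 0"
  shows "S = 0"
proof (rule poly_eqI)
  fix n
  show "coeff S n = coeff 0 n"
    using rel
  proof (induction n arbitrary: P S)
    case 0
    then show ?case using heine_independent_0[OF adm] by simp
  next
    case (Suc n)
    note 0 = heine_independent_0[OF adm Suc.prems]
    obtain P' S' where PS: "P = pCons 0 P'" "S = pCons 0 S'"
      using 0 by (metis coeff_pCons_0 pCons_cases)
    have "fps_X * (fps_of_poly P' * heine_fps (a * q) (b * q) (c * q) q + fps_of_poly S' * heine_fps a b c q) = 0"
      using Suc.prems by (simp add: PS fps_of_poly_pCons algebra_simps)
    then have "fps_of_poly P' * heine_fps (a * q) (b * q) (c * q) q + fps_of_poly S' * heine_fps a b c q = 0"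
      by simp
    from Suc.IH[OF this] show ?case by (simp add: PS)
  qed
qed

lemma heine_independent:
  assumes adm: "admissible a b c q"
    and rel: "\<And>x. norm x < 1 \<Longrightarrow>
      poly P x * heine_phi (a * q) (b * q) (c * q) q x + poly S x * heine_phi a b c q x = 0"
  shows "S = 0"
proof (rule heine_independent_fps[OF adm], rule eval_fps_eqD)
  let ?f = "fps_of_poly P * heine_fps (a * q) (b * q) (c * q) q"
  let ?g = "fps_of_poly S * heine_fps a b c q"
  note eval_f = eval_poly_times_heine_fps[OF admissible_shift[OF adm]]
  note eval_g = eval_poly_times_heine_fps[OF adm]
  show "fps_conv_radius (?f + ?g) > 0"
    using fps_conv_radius_add[of ?f ?g] eval_f(1)[of 0 P] eval_g(1)[of 0 S]
    by (auto simp: zero_ereal_def min_def split: if_splits)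
  have "eval_fps (?f + ?g) x = 0" if "norm x < 1" for x
    using eval_f[OF that] eval_g[OF that] rel[OF that] by (simp add: eval_fps_add)
  moreover have "eventually (\<lambda>x::complex. norm x < 1) (nhds 0)"
    using eventually_nhds_in_open[of "ball 0 1" "0 :: complex"] by simp
  ultimately show "\<forall>\<^sub>F z in nhds 0. eval_fps (?f + ?g) z = eval_fps 0 z"
    by (auto elim: eventually_mono)
qed simp

section \<open>Comparing coefficients\<close>

theorem corollary6:
  fixes Q R :: "int \<Rightarrow> int \<Rightarrow> int \<Rightarrow> ratfun5"
    and k l m :: int
  assumes three_term: "\<And>k l m. three_term_relation k l m (Q k l m) (R k l m)"
  shows "ratfun5_eval (Q (k - 1) (l - 1) (m - 1))
           (var_a * var_q) (var_b * var_q) (var_c * var_q) var_q var_x =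
         (1 - var_a * var_q) * (1 - var_b * var_q) * var_x *
           (var_c - var_a * var_b * var_q * var_x) /
           ((1 - var_c) * (1 - var_c * var_q)) * R k l m"
proof -
  define Q' where "Q' = Q (k - 1) (l - 1) (m - 1)"
  define R' where "R' = R (k - 1) (l - 1) (m - 1)"
  let ?num = "\<lambda>f::ratfun5. fst (quot_of_fract f)"
  let ?den = "\<lambda>f::ratfun5. snd (quot_of_fract f)"
  obtain n3 where n3:
      "pol5_eval (?num Q') (var_a * var_q) (var_b * var_q) (var_c * var_q) var_q var_x = to_fract n3"
      "\<And>a b c q x :: complex. pol5_eval n3 a b c q x = pol5_eval (?num Q') (a * q) (b * q) (c * q) q x"
    using pol5_shift[of "?num Q'"] by blast
  obtain d3 where d3:
      "pol5_eval (?den Q') (var_a * var_q) (var_b * var_q) (var_c * var_q) var_q var_x = to_fract d3"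
      "\<And>a b c q x :: complex. pol5_eval d3 a b c q x = pol5_eval (?den Q') (a * q) (b * q) (c * q) q x"
    using pol5_shift[of "?den Q'"] by blast
  obtain n4 where 
      "pol5_eval (?num R') (var_a * var_q) (var_b * var_q) (var_c * var_q) var_q var_x = to_fract n4"
      and n4: "\<And>a b c q x :: complex. pol5_eval n4 a b c q x = pol5_eval (?num R') (a * q) (b * q) (c * q) q x"
    using pol5_shift[of "?num R'"] by blast
  obtain d4 where 
      "pol5_eval (?den R') (var_a * var_q) (var_b * var_q) (var_c * var_q) var_q var_x = to_fract d4"
      and d4: "\<And>a b c q x :: complex. pol5_eval d4 a b c q x = pol5_eval (?den R') (a * q) (b * q) (c * q) q x"
    using pol5_shift[of "?den R'"] by blast
  define n1 d1 n2 d2 where "n1 = ?num (Q k l m)" and "d1 = ?den (Q k l m)"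
    and "n2 = ?num (R k l m)" and "d2 = ?den (R k l m)"
  have nz: "d1 \<noteq> 0" "d2 \<noteq> 0" "d3 \<noteq> 0" "d4 \<noteq> 0"
    using pol5_shift_nonzero[OF _ d3(2)] pol5_shift_nonzero[OF _ d4]
    by (auto simp: d1_def d2_def)
  \<comment> \<open>The contiguous relation reads \<open>e \<phi>\<^sub>2 = - h \<phi>\<^sub>1 + \<kappa> \<phi>\<^sub>0\<close>.\<close>
  define e where "e = px * (pc - pa * pb * pq * px) * (1 - pa * pq) * (1 - pb * pq)"
  define h where "h = (1 - pc * pq) * (1 - pc + (pa * pb - pa - pb + pa * pb * pq) * px)"
  define \<kappa> where "\<kappa> = (1 - pc) * (1 - pc * pq)"
  define D where "D = d1 * d2 * d3 * d4"
  \<comment> \<open>\<open>P\<close> and \<open>S\<close> are the coefficients of \<open>\<phi>\<^sub>1\<close> and \<open>\<phi>\<^sub>0\<close> in the difference of the two expressions for the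
    same series, multiplied by \<open>d1 d2 d3 d4 e\<close> to clear denominators. The further factor \<open>D\<close> makes the
    relation trivially true at the poles, where nothing is assumed.\<close>
  define P where "P = (n1 * d2 * d3 * d4 * e - n4 * d1 * d2 * d3 * e + n3 * d1 * d2 * d4 * h) * D"
  define S where "S = (n2 * d3 * e - n3 * d2 * \<kappa>) * d1 * d4 * D"
  have "n2 * d3 * e - n3 * d2 * \<kappa> = 0"
  proof (rule ccontr)
    assume "n2 * d3 * e - n3 * d2 * \<kappa> \<noteq> 0"
    then have "S \<noteq> 0" using nz by (simp add: S_def D_def)
    then obtain a b c q x0 :: complex
      where adm: "admissible a b c q" and x0: "pol5_eval S a b c q x0 \<noteq> 0"
      by (rule pol5_nonvanishing)
    note adm' = admissible_shift[OF adm]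
    have q: "q \<noteq> 0" using adm by (auto simp: admissible_def)
    obtain Px where Px: "\<And>x. poly Px x = pol5_eval P a b c q x"
      using pol5_eval_poly_x by blast
    obtain Sx where Sx: "\<And>x. poly Sx x = pol5_eval S a b c q x"
      using pol5_eval_poly_x by blast
    have "Sx = 0"
    proof (rule heine_independent[OF adm])
      fix x :: complex
      assume x: "norm x < 1"
      let ?v = "\<lambda>p. pol5_eval p a b c q x"
      define f where "f = heine_phi (a * q powi k) (b * q powi l) (c * q powi m) q x"
      define \<phi>0 \<phi>1 \<phi>2 where "\<phi>0 = heine_phi a b c q x"
        and "\<phi>1 = heine_phi (a * q) (b * q) (c * q) q x"
        and "\<phi>2 = heine_phi (a * q * q) (b * q * q) (c * q * q) q x"
      have "?v P * \<phi>1 + ?v S * \<phi>0 = 0"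
      proof (cases "?v D = 0")
        case True
        then show ?thesis by (simp add: P_def S_def pol5_eval_hom)
      next
        case False
        then have d: "?v d1 \<noteq> 0" "?v d2 \<noteq> 0" "?v d3 \<noteq> 0" "?v d4 \<noteq> 0"
          by (simp_all add: D_def pol5_eval_hom)
        have "f = ?v n1 / ?v d1 * \<phi>1 + ?v n2 / ?v d2 * \<phi>0"
          using three_term[of k l m] adm x d
          by (simp add: three_term_relation_def ratfun5_defined_def ratfun5_eval_def
              f_def \<phi>0_def \<phi>1_def n1_def d1_def n2_def d2_def)
        then have 1: "f * ?v d1 * ?v d2 = ?v n1 * ?v d2 * \<phi>1 + ?v n2 * ?v d1 * \<phi>0"
          using d by (simp add: field_simps)
        have shift: "u * q * q powi (i - 1) = u * q powi i" for u i
          using q by (simp add: power_int_diff)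
        have "f = ?v n3 / ?v d3 * \<phi>2 + ?v n4 / ?v d4 * \<phi>1"
          using three_term[of "k - 1" "l - 1" "m - 1", unfolded three_term_relation_def,
              THEN spec[where x = "a * q"], THEN spec[where x = "b * q"],
              THEN spec[where x = "c * q"], THEN spec[where x = q], THEN spec[where x = x]]
            adm' x d
          by (simp add: ratfun5_defined_def ratfun5_eval_def shift
              f_def \<phi>1_def \<phi>2_def n3 d3 n4 d4 flip: Q'_def R'_def)
        then have 2: "f * ?v d3 * ?v d4 = ?v n3 * ?v d4 * \<phi>2 + ?v n4 * ?v d3 * \<phi>1"
          using d by (simp add: field_simps)
        have 3: "?v e * \<phi>2 = - ?v h * \<phi>1 + ?v \<kappa> * \<phi>0"
          using heine_contiguous[OF adm x]
          by (simp add: e_def h_def \<kappa>_def \<phi>0_def \<phi>1_def \<phi>2_def pol5_eval_hom pol5_eval_diff pol5_eval_var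
              del: minus_diff_eq)
        have "(?v n1 * ?v d2 * \<phi>1 + ?v n2 * ?v d1 * \<phi>0) * ?v d3 * ?v d4 * ?v e =
            (?v n3 * ?v d4 * (?v e * \<phi>2) + ?v n4 * ?v d3 * \<phi>1 * ?v e) * ?v d1 * ?v d2"
          using 1 2 by algebra
        then show ?thesis
          unfolding 3 P_def S_def pol5_eval_hom pol5_eval_diff by algebra
      qed
      then show "poly Px x * heine_phi (a * q) (b * q) (c * q) q x + poly Sx x * heine_phi a b c q x = 0"
        by (simp add: Px Sx \<phi>0_def \<phi>1_def)
    qed
    then show False using x0 Sx[of x0] by simp
  qed
  then have "to_fract (n3 * d2 * \<kappa>) = to_fract (n2 * d3 * e)" by simp
  then have eq: "to_fract n3 * to_fract d2 * to_fract \<kappa> = to_fract n2 * to_fract d3 * to_fract e"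
    by simp
  have \<kappa>: "to_fract \<kappa> = (1 - var_c) * (1 - var_c * var_q)"
    and e: "to_fract e = (1 - var_a * var_q) * (1 - var_b * var_q) * var_x *
      (var_c - var_a * var_b * var_q * var_x)"
    by (simp_all add: \<kappa>_def e_def var_eq_to_fract mult_ac)
  have "pol5_eval \<kappa> 0 0 0 0 (0::complex) = 1"
    by (simp add: \<kappa>_def pol5_eval_hom pol5_eval_diff pol5_eval_var)
  then have "\<kappa> \<noteq> 0" by (auto simp: pol5_eval_hom)
  have R: "R k l m = to_fract n2 / to_fract d2"
    by (simp add: n2_def d2_def flip: Fract_conv_to_fract)
  have "ratfun5_eval Q' (var_a * var_q) (var_b * var_q) (var_c * var_q) var_q var_x =
      to_fract n3 / to_fract d3"
    by (simp add: ratfun5_eval_def n3 d3)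
  also have "\<dots> = to_fract e / to_fract \<kappa> * R k l m"
    using eq nz \<open>\<kappa> \<noteq> 0\<close> by (simp add: R frac_eq_eq mult_ac)
  finally show ?thesis
    by (simp only: Q'_def \<kappa> e)
qed

end
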